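(* Let $H$ be a real Hilbert space and let $G$ be a group of orthogonal transformations of $H$. Let $W$ and $R$ be $G$-stable subsets of $H$ such that $W$ is weakly compact and, for each $k\in\mathbb{N}$, the orbit space $R^k/G$ is compact. Then the orbit space $(W,d_R)/G$ is compact.
   Context: A subset $Y\subseteq H$ is $G$-stable if $g\cdot y\in Y$ for all $g\in G$, $y\in Y$. $W$ is weakly compact if it is compact in the weak topology of $H$. For a topological space $X$ with a $G$-action, the orbit space $X/G$ is the quotient space whose classes are the $G$-orbits. $R^k$ carries the product of the norm topology of $H$, and $G$ acts on $R^k$ diagonally. For bounded $R$ (and in general with values in $[0,\infty]$) one defines the seminorm $\|x\|_R:=\sup_{r\in R}|\langle r,x\rangle|$ and the pseudometric $d_R(x,y):=\|x-y\|_R$ on $H$; $(W,d_R)$ denotes $W$ with the topology induced by $d_R$. *)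

theory Defs
  imports "HOL-Analysis.Analysis" "HOL-Algebra.Group_Action"
begin

text \<open>In infinite dimension \<^const>\<open>orthogonal_transformation\<close> only says linear isometry, so
  surjectivity has to be required separately.\<close>

definition orthogonal_group :: "('a::real_inner \<Rightarrow> 'a) monoid" where
  "orthogonal_group =
     \<lparr>carrier = {f. orthogonal_transformation f \<and> surj f}, mult = (\<circ>), one = id\<rparr>"

lemma group_orthogonal_group: "group (orthogonal_group :: ('a::real_inner \<Rightarrow> 'a) monoid)"
proof (rule groupI)
  fix f :: "'a \<Rightarrow> 'a"
  assume f: "f \<in> carrier orthogonal_group"
  then have lin: "linear f" and iso: "\<And>v w. f v \<bullet> f w = v \<bullet> w" and s: "surj f"
    by (auto simp: orthogonal_group_def orthogonal_transformation_def)
  have "f x = f y \<longleftrightarrow> x = y" for x y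
    using linear_diff[OF lin, of x y] iso[of "x - y" "x - y"]
    by (metis inner_eq_zero_iff right_minus_eq)
  then have "inj f"
    by (simp add: inj_def)
  then have inv: "inv_into UNIV f (f x) = x" "f (inv_into UNIV f x) = x" for x
    using s by (simp_all add: surj_f_inv_f)
  have "linear (inv_into UNIV f)"
  proof (rule linearI)
    show "inv_into UNIV f (v + w) = inv_into UNIV f v + inv_into UNIV f w" for v w
      using inv(1)[of "inv_into UNIV f v + inv_into UNIV f w"] inv(2) linear_add[OF lin] by simp
    show "inv_into UNIV f (c *\<^sub>R v) = c *\<^sub>R inv_into UNIV f v" for c v
      using inv(1)[of "c *\<^sub>R inv_into UNIV f v"] inv(2) linear_scale[OF lin] by simp
  qed
  moreover have "inv_into UNIV f v \<bullet> inv_into UNIV f w = v \<bullet> w" for v w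
    by (metis inv(2) iso)
  moreover have "surj (inv_into UNIV f)"
    by (metis inv(1) surj_def)
  ultimately have "inv_into UNIV f \<in> carrier orthogonal_group"
    by (simp add: orthogonal_group_def orthogonal_transformation_def)
  moreover have "inv_into UNIV f \<circ> f = id"
    using inv by auto
  ultimately show "\<exists>g\<in>carrier orthogonal_group. g \<otimes>\<^bsub>orthogonal_group\<^esub> f = \<one>\<^bsub>orthogonal_group\<^esub>"
    by (auto simp: orthogonal_group_def)
qed (auto simp: orthogonal_group_def o_assoc comp_surj orthogonal_transformation_def
       intro: linear_compose linear_id, metis rangeI surjD)

definition G_stable :: "('a \<Rightarrow> 'a) set \<Rightarrow> 'a set \<Rightarrow> bool" where
  "G_stable G Y \<longleftrightarrow> (\<forall>g\<in>G. \<forall>y\<in>Y. g y \<in> Y)"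

text \<open>The coarsest topology for which all continuous linear functionals are continuous.\<close>

definition weak_topology :: "'a::real_normed_vector topology" where
  "weak_topology =
     topology_generated_by {\<phi> -` U | (\<phi> :: 'a \<Rightarrow> real) U. bounded_linear \<phi> \<and> open U}"

definition orbit_space ::
    "('g, 'm) monoid_scheme \<Rightarrow> ('g \<Rightarrow> 'x \<Rightarrow> 'x) \<Rightarrow> 'x topology \<Rightarrow> 'x set topology" where
  "orbit_space G \<phi> X = topology (\<lambda>U. U \<subseteq> orbits G (topspace X) \<phi> \<and>
     openin X {x \<in> topspace X. orbit G \<phi> x \<in> U})"

lemma openin_orbit_space:
  "openin (orbit_space G \<phi> X) U \<longleftrightarrow>
     U \<subseteq> orbits G (topspace X) \<phi> \<and> openin X {x \<in> topspace X. orbit G \<phi> x \<in> U}"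
proof -
  have "istopology (\<lambda>U. U \<subseteq> orbits G (topspace X) \<phi> \<and>
     openin X {x \<in> topspace X. orbit G \<phi> x \<in> U})"
    unfolding istopology_def
  proof (intro conjI allI impI; (elim conjE)?)
    fix S T
    assume "openin X {x \<in> topspace X. orbit G \<phi> x \<in> S}"
      and "openin X {x \<in> topspace X. orbit G \<phi> x \<in> T}"
    then have "openin X ({x \<in> topspace X. orbit G \<phi> x \<in> S} \<inter> {x \<in> topspace X. orbit G \<phi> x \<in> T})"
      by blast
    then show "openin X {x \<in> topspace X. orbit G \<phi> x \<in> S \<inter> T}"
      by (rule back_subst[of "openin X"]) auto
  next
    fix K
    assume K: "\<forall>U\<in>K. U \<subseteq> orbits G (topspace X) \<phi> \<and>
      openin X {x \<in> topspace X. orbit G \<phi> x \<in> U}"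
    then have "openin X (\<Union>U\<in>K. {x \<in> topspace X. orbit G \<phi> x \<in> U})"
      by blast
    then show "openin X {x \<in> topspace X. orbit G \<phi> x \<in> \<Union>K}"
      by (rule back_subst[of "openin X"]) auto
  qed auto
  then show ?thesis
    by (simp add: orbit_space_def topology_inverse')
qed

lemma topspace_orbit_space [simp]: "topspace (orbit_space G \<phi> X) = orbits G (topspace X) \<phi>"
proof -
  have "{x \<in> topspace X. orbit G \<phi> x \<in> orbits G (topspace X) \<phi>} = topspace X"
    by (auto simp: orbits_def)
  then have "openin (orbit_space G \<phi> X) (orbits G (topspace X) \<phi>)"
    by (simp add: openin_orbit_space)
  then show ?thesis
    by (metis openin_orbit_space openin_subset openin_topspace subset_antisym)
qed

lemma quotient_map_orbit: "quotient_map X (orbit_space G \<phi> X) (orbit G \<phi>)"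
proof -
  have "orbit G \<phi> ` topspace X = orbits G (topspace X) \<phi>"
    by (auto simp: orbits_def)
  then show ?thesis
    by (simp add: quotient_map_def openin_orbit_space)
qed

text \<open>The space \<open>R\<^sup>k\<close>, as extensional functions on \<open>{..<k}\<close>, and the diagonal action on it.\<close>

definition power_space :: "'a::topological_space set \<Rightarrow> nat \<Rightarrow> (nat \<Rightarrow> 'a) topology" where
  "power_space R k = product_topology (\<lambda>_. top_of_set R) {..<k}"

definition diag_action :: "nat \<Rightarrow> ('a \<Rightarrow> 'a) \<Rightarrow> (nat \<Rightarrow> 'a) \<Rightarrow> (nat \<Rightarrow> 'a)" where
  "diag_action k g x = (\<lambda>i\<in>{..<k}. g (x i))"

text \<open>With values in \<^typ>\<open>ennreal\<close>, the supremum over an empty \<open>R\<close> is \<open>0\<close> and the supremum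
  over an unbounded set is \<open>\<infinity>\<close>.\<close>

definition snorm_R :: "'a::real_inner set \<Rightarrow> 'a \<Rightarrow> ennreal" where
  "snorm_R R x = (SUP r\<in>R. ennreal \<bar>r \<bullet> x\<bar>)"

definition d_R :: "'a::real_inner set \<Rightarrow> 'a \<Rightarrow> 'a \<Rightarrow> ennreal" where
  "d_R R x y = snorm_R R (x - y)"

definition dR_space :: "'a::real_inner set \<Rightarrow> 'a set \<Rightarrow> 'a topology" where
  "dR_space W R = topology (\<lambda>U. U \<subseteq> W \<and> (\<forall>x\<in>U. \<exists>e>0. \<forall>y\<in>W. d_R R x y < e \<longrightarrow> y \<in> U))"

lemma openin_dR_space:
  "openin (dR_space W R) U \<longleftrightarrow> U \<subseteq> W \<and> (\<forall>x\<in>U. \<exists>e>0. \<forall>y\<in>W. d_R R x y < e \<longrightarrow> y \<in> U)"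
proof -
  have "istopology (\<lambda>U. U \<subseteq> W \<and> (\<forall>x\<in>U. \<exists>e>0. \<forall>y\<in>W. d_R R x y < e \<longrightarrow> y \<in> U))"
    unfolding istopology_def
  proof (intro conjI allI impI; (elim conjE)?)
    fix S T
    assume S: "\<forall>x\<in>S. \<exists>e>0. \<forall>y\<in>W. d_R R x y < e \<longrightarrow> y \<in> S"
      and T: "\<forall>x\<in>T. \<exists>e>0. \<forall>y\<in>W. d_R R x y < e \<longrightarrow> y \<in> T"
    show "\<forall>x\<in>S \<inter> T. \<exists>e>0. \<forall>y\<in>W. d_R R x y < e \<longrightarrow> y \<in> S \<inter> T"
    proof
      fix x assume "x \<in> S \<inter> T"
      then obtain a b where "a > 0" "\<forall>y\<in>W. d_R R x y < a \<longrightarrow> y \<in> S"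
        and "b > 0" "\<forall>y\<in>W. d_R R x y < b \<longrightarrow> y \<in> T"
        using S T by blast
      then show "\<exists>e>0. \<forall>y\<in>W. d_R R x y < e \<longrightarrow> y \<in> S \<inter> T"
        by (intro exI[of _ "min a b"]) auto
    qed
  next
    fix K
    assume K: "\<forall>U\<in>K. U \<subseteq> W \<and> (\<forall>x\<in>U. \<exists>e>0. \<forall>y\<in>W. d_R R x y < e \<longrightarrow> y \<in> U)"
    show "\<forall>x\<in>\<Union>K. \<exists>e>0. \<forall>y\<in>W. d_R R x y < e \<longrightarrow> y \<in> \<Union>K"
      using K by (metis UnionE UnionI)
  qed auto
  then show ?thesis
    by (simp add: dR_space_def topology_inverse')
qed

lemma topspace_dR_space [simp]: "topspace (dR_space W R) = W"
proof -
  have "openin (dR_space W R) W"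
    by (auto simp: openin_dR_space intro: exI[of _ 1])
  then show ?thesis
    by (metis openin_dR_space openin_subset openin_topspace subset_antisym)
qed

end

(* After a uniform boundedness argument the theorem becomes a "complete and totally bounded"
   argument for the G-invariant pseudometric d_R on W.

   Total boundedness modulo G: if |<r,x>| > e for some r in R, then subtracting a suitable
   multiple +-delta r from x decreases the squared norm of x by at least delta e. Hence every
   x in W is within e, in d_R, of a sum of boundedly many terms +-delta r_i with r_i in R, and the
   tuple (r_1, ..., r_k) can be replaced, up to G, by one from a finite net of R^k, because R^k/G
   is compact.

   Completeness: closed d_R-balls are weakly closed, so nested ones have a common point in the
   weakly compact set W. *)

theory Submission
  imports Defs
begin

subsection \<open>Weakly compact sets\<close>

lemma openin_weak_vimage:
  "bounded_linear \<phi> \<Longrightarrow> open U \<Longrightarrow> openin weak_topology (\<phi> -` U)" for \<phi> :: "_ \<Rightarrow> real"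
  unfolding weak_topology_def by (rule topology_generated_by_Basis) blast

lemma topspace_weak_topology [simp]: "topspace weak_topology = UNIV"
  using openin_subset[OF openin_weak_vimage[OF bounded_linear_zero open_UNIV]] by auto

lemma continuous_map_weak_topology:
  "bounded_linear \<phi> \<Longrightarrow> continuous_map weak_topology euclideanreal \<phi>"
  using openin_weak_vimage by (auto simp: continuous_map_def vimage_def)

text \<open>Uniform boundedness by Baire: weak compactness makes each functional
  \<open>(\<bullet>) x\<close> bounded on \<open>W\<close>, so the closed sets \<open>T n\<close>
  cover the complete space and one of them contains a ball.\<close>

lemma weakly_compact_imp_bounded:
  fixes W :: "'a::{real_inner, complete_space} set"
  assumes "compactin weak_topology W"
  shows "bounded W"
proof -
  define T where "T n = {x. \<forall>w\<in>W. \<bar>x \<bullet> w\<bar> \<le> real n}" for n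
  have closed: "closed (T n)" for n
  proof -
    have "T n = (\<Inter>w\<in>W. {x. \<bar>x \<bullet> w\<bar> \<le> real n})"
      by (auto simp: T_def)
    moreover have "closed {x. \<bar>x \<bullet> w\<bar> \<le> real n}" for w :: 'a
      by (intro closed_Collect_le continuous_intros)
    ultimately show ?thesis
      by auto
  qed
  have "\<exists>n. x \<in> T n" for x
  proof -
    have "compact ((\<bullet>) x ` W)"
      using image_compactin[OF assms continuous_map_weak_topology[OF bounded_linear_inner_right]]
      by simp
    then obtain b where "\<And>w. w \<in> W \<Longrightarrow> \<bar>x \<bullet> w\<bar> \<le> b"
      by (meson bounded_real compact_imp_bounded imageI)
    moreover obtain n where "b \<le> real n"
      using real_arch_simple by blast
    ultimately show ?thesis
      unfolding T_def mem_Collect_eq by (meson order_trans)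
  qed
  then have cover: "\<Union>(range T) = UNIV"
    by blast
  have "Met_TC.mcomplete TYPE('a)"
    unfolding Met_TC.mcomplete_def
    by (simp add: Cauchy_convergent_iff convergent_def)
  then obtain n where "interior (T n) \<noteq> {}"
    using Met_TC.metric_Baire_category_alt[of "range T"] closed cover by auto
  then obtain x d where d: "d > 0" "cball x d \<subseteq> T n"
    by (meson all_not_in_conv mem_interior_cball)
  have "norm w \<le> 2 * real n / d" if "w \<in> W" for w
  proof (cases "w = 0")
    case False
    \<comment> \<open>\<open>u\<close> is \<open>w\<close> rescaled to length \<open>d\<close>, so
      \<open>x\<close> and \<open>x + u\<close> both lie in the ball. Hence
      \<open>u \<bullet> w\<close>, which equals \<open>d * norm w\<close>, is at most
      \<open>2 * real n\<close>.\<close>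
    define u where "u = (d / norm w) *\<^sub>R w"
    have "norm u = d"
      using False d by (simp add: u_def)
    then have "x \<in> T n" "x + u \<in> T n"
      using d by (auto simp: dist_norm intro!: subsetD[OF d(2)])
    then have "\<bar>x \<bullet> w\<bar> \<le> real n" "\<bar>(x + u) \<bullet> w\<bar> \<le> real n"
      using that by (auto simp: T_def)
    then have "u \<bullet> w \<le> 2 * real n"
      by (simp add: inner_add_left)
    moreover have "u \<bullet> w = d * norm w"
      using False by (simp add: u_def power2_norm_eq_inner[symmetric] power2_eq_square)
    ultimately show ?thesis
      using d by (simp add: field_simps)
  qed (use d in auto)
  then show ?thesis
    by (rule boundedI)
qed

subsection \<open>The seminorm given by R\<close>

text \<open>\<open>R_close R e x y\<close> says \<open>d_R R x y \<le> e\<close>, but in terms of reals.\<close>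

definition R_close :: "'a::real_inner set \<Rightarrow> real \<Rightarrow> 'a \<Rightarrow> 'a \<Rightarrow> bool" where
  "R_close R e x y \<longleftrightarrow> (\<forall>r\<in>R. \<bar>r \<bullet> (x - y)\<bar> \<le> e)"

lemma R_close_imp_d_R_le: "R_close R e x y \<Longrightarrow> d_R R x y \<le> ennreal e"
  by (auto simp: R_close_def d_R_def snorm_R_def intro!: SUP_least ennreal_leI)

lemma R_close_sym: "R_close R e x y \<Longrightarrow> R_close R e y x"
  by (simp add: R_close_def inner_diff_right abs_minus_commute)

lemma R_close_trans: "R_close R d x y \<Longrightarrow> R_close R e y z \<Longrightarrow> R_close R (d + e) x z"
  unfolding R_close_def by (fastforce simp: inner_diff_right)

lemma R_close_mono: "R_close R d x y \<Longrightarrow> d \<le> e \<Longrightarrow> R_close R e x y"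
  unfolding R_close_def by fastforce

lemma R_close_self: "0 \<le> e \<Longrightarrow> R_close R e x x"
  by (simp add: R_close_def)

lemma norm_imp_R_close:
  assumes "\<And>r. r \<in> R \<Longrightarrow> norm r \<le> C" and "C * norm (x - y) \<le> e"
  shows "R_close R e x y"
  unfolding R_close_def
proof
  fix r assume "r \<in> R"
  then have "\<bar>r \<bullet> (x - y)\<bar> \<le> C * norm (x - y)"
    using Cauchy_Schwarz_ineq2[of r "x - y"] mult_right_mono[OF assms(1), of r "norm (x - y)"]
    by force
  then show "\<bar>r \<bullet> (x - y)\<bar> \<le> e"
    using assms(2) by linarith
qed

text \<open>An intersection of preimages of closed intervals under weakly continuous functionals.
  This is what lets weak compactness of \<open>W\<close> produce limits for
  \<open>R_close\<close>.\<close>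

lemma closedin_weak_R_close: "closedin weak_topology {y. R_close R e x y}"
proof -
  have "closedin weak_topology {y. \<bar>r \<bullet> (x - y)\<bar> \<le> e}" for r
  proof -
    have "closedin weak_topology {y \<in> topspace weak_topology. r \<bullet> y \<in> {r \<bullet> x - e..r \<bullet> x + e}}"
      by (rule closedin_continuous_map_preimage
          [OF continuous_map_weak_topology[OF bounded_linear_inner_right]]) simp
    moreover have "{y \<in> topspace weak_topology. r \<bullet> y \<in> {r \<bullet> x - e..r \<bullet> x + e}} =
        {y. \<bar>r \<bullet> (x - y)\<bar> \<le> e}"
      by (auto simp: inner_diff_right abs_le_iff)
    ultimately show ?thesis
      by simp
  qed
  moreover have "{y. R_close R e x y} =
      topspace weak_topology \<inter> (\<Inter>r\<in>R. {y. \<bar>r \<bullet> (x - y)\<bar> \<le> e})"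
    by (auto simp: R_close_def)
  \<comment> \<open>For empty \<open>R\<close> the set is the whole space; closedness of an
    intersection is available for nonempty families.\<close>
  ultimately show ?thesis
    by (cases "R = {}")
      (auto simp: closedin_topspace[of weak_topology, unfolded topspace_weak_topology])
qed

text \<open>Greedy choice by induction on \<open>K\<close>: the bound on the squared norm is a
  budget of \<open>K\<close> steps, each of which uses up \<open>\<delta> * e\<close>. With no
  budget left, \<open>x\<close> is zero and the empty sum serves.\<close>

lemma signed_sum_approximation:
  fixes R :: "'a::real_inner set"
  assumes C: "\<And>r. r \<in> R \<Longrightarrow> norm r \<le> C" and \<delta>: "\<delta> > 0" "\<delta> * C\<^sup>2 \<le> e" and "e \<ge> 0"
  shows "(norm x)\<^sup>2 \<le> real K * (\<delta> * e) \<Longrightarrow>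
    \<exists>k\<le>K. \<exists>s r. (\<forall>i<k. s i \<in> {-1, 1::real} \<and> r i \<in> R) \<and>
      R_close R e x (\<delta> *\<^sub>R (\<Sum>i<k. s i *\<^sub>R r i))"
proof (induction K arbitrary: x)
  case 0
  then show ?case
    using \<open>e \<ge> 0\<close> by (simp add: R_close_self)
next
  case (Suc K)
  show ?case
  proof (cases "R_close R e x 0")
    case True
    then show ?thesis
      by (intro exI[of _ 0]) simp
  next
    case False
    then obtain q where q: "q \<in> R" "\<bar>q \<bullet> x\<bar> > e"
      by (auto simp: R_close_def)
    define t :: real where "t = (if q \<bullet> x > 0 then 1 else -1)"
    have t: "t \<in> {-1, 1}" "t * (q \<bullet> x) = \<bar>q \<bullet> x\<bar>" "t * t = 1"
      by (auto simp: t_def)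
    define x' where "x' = x - (\<delta> * t) *\<^sub>R q"
    have "(norm x')\<^sup>2 = (norm x)\<^sup>2 - 2 * \<delta> * (t * (q \<bullet> x)) + \<delta> * \<delta> * (t * t) * (norm q)\<^sup>2"
      unfolding x'_def power2_norm_eq_inner
      by (simp add: inner_diff_left inner_diff_right inner_commute algebra_simps)
    also have "\<dots> = (norm x)\<^sup>2 - 2 * \<delta> * \<bar>q \<bullet> x\<bar> + \<delta> * (\<delta> * (norm q)\<^sup>2)"
      by (simp add: t)
    \<comment> \<open>The cross term removes at least \<open>2 * \<delta> * e\<close> by the choice
      of \<open>q\<close>, while \<open>\<delta> * C\<^sup>2 \<le> e\<close> limits the quadratic
      term to \<open>\<delta> * e\<close>.\<close>
    also have "\<dots> \<le> (norm x)\<^sup>2 - 2 * \<delta> * e + \<delta> * e"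
    proof -
      have "\<delta> * (norm q)\<^sup>2 \<le> \<delta> * C\<^sup>2"
        using C[OF q(1)] \<delta>(1) by (simp add: power_mono)
      then have "\<delta> * (\<delta> * (norm q)\<^sup>2) \<le> \<delta> * e"
        using \<delta> by (intro mult_left_mono) linarith+
      moreover have "\<delta> * e \<le> \<delta> * \<bar>q \<bullet> x\<bar>"
        using q \<delta> by (intro mult_left_mono) auto
      ultimately show ?thesis
        by linarith
    qed
    also have "\<dots> \<le> real K * (\<delta> * e)"
      using Suc.prems by (simp add: algebra_simps)
    finally obtain k s r where k: "k \<le> K" and sr: "\<forall>i<k. s i \<in> {-1, 1::real} \<and> r i \<in> R"
      and close: "R_close R e x' (\<delta> *\<^sub>R (\<Sum>i<k. s i *\<^sub>R r i))"
      using Suc.IH by blast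
    define s' r' where "s' = s(k := t)" and "r' = r(k := q)"
    have "(\<Sum>i<Suc k. s' i *\<^sub>R r' i) = (\<Sum>i<k. s i *\<^sub>R r i) + t *\<^sub>R q"
      by (simp add: s'_def r'_def)
    then have "R_close R e x (\<delta> *\<^sub>R (\<Sum>i<Suc k. s' i *\<^sub>R r' i))"
      using close by (simp add: R_close_def x'_def scaleR_add_right algebra_simps)
    moreover have "\<forall>i<Suc k. s' i \<in> {-1, 1} \<and> r' i \<in> R"
      using sr t(1) q(1) by (auto simp: s'_def r'_def less_Suc_eq)
    ultimately show ?thesis
      using k by (intro exI[of _ "Suc k"]) blast
  qed
qed

subsection \<open>Nets modulo the group\<close>

locale orthogonal_subgroup =
  fixes G :: "('a::real_inner \<Rightarrow> 'a) set"
  assumes subgroup: "subgroup G orthogonal_group"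
begin

lemma G_orthogonal: "g \<in> G \<Longrightarrow> orthogonal_transformation g"
  using subgroup.subset[OF subgroup] by (auto simp: orthogonal_group_def)

lemma G_linear: "g \<in> G \<Longrightarrow> linear g"
  using G_orthogonal orthogonal_transformation_def by blast

lemma G_inner: "g \<in> G \<Longrightarrow> g x \<bullet> g y = x \<bullet> y"
  using G_orthogonal orthogonal_transformation_def by blast

lemma G_norm_diff: "g \<in> G \<Longrightarrow> norm (g x - g y) = norm (x - y)"
  by (metis G_linear G_orthogonal linear_diff orthogonal_transformation_norm)

lemma G_id: "id \<in> G"
  using subgroup.one_closed[OF subgroup] by (simp add: orthogonal_group_def)

lemma G_comp: "g \<in> G \<Longrightarrow> h \<in> G \<Longrightarrow> g \<circ> h \<in> G"
  using subgroup.m_closed[OF subgroup] by (simp add: orthogonal_group_def)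

lemma G_inverse:
  assumes "g \<in> G"
  obtains h where "h \<in> G" "\<And>x. h (g x) = x" "\<And>x. g (h x) = x"
proof -
  interpret O: group "orthogonal_group :: ('a \<Rightarrow> 'a) monoid"
    by (rule group_orthogonal_group)
  define h where "h = inv\<^bsub>orthogonal_group\<^esub> g"
  have g: "g \<in> carrier orthogonal_group"
    using assms subgroup.subset[OF subgroup] by blast
  have "h \<circ> g = id" "g \<circ> h = id"
    using O.l_inv[OF g] O.r_inv[OF g] by (simp_all add: h_def orthogonal_group_def)
  moreover have "h \<in> G"
    unfolding h_def using subgroup.m_inv_closed[OF subgroup assms] .
  ultimately show thesis
    using that by (metis comp_apply id_apply)
qed

text \<open>Invariance: the inverse of \<open>g\<close> can be moved onto \<open>r\<close>, and
  stability keeps the result in \<open>R\<close>.\<close>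

lemma R_close_G:
  assumes "G_stable G R" "g \<in> G" "R_close R e x y"
  shows "R_close R e (g x) (g y)"
  unfolding R_close_def
proof
  fix r assume r: "r \<in> R"
  obtain h where h: "h \<in> G" "\<And>x. h (g x) = x" "\<And>x. g (h x) = x"
    using G_inverse[OF assms(2)] by blast
  have "r \<bullet> (g x - g y) = g (h r) \<bullet> g (x - y)"
    using h linear_diff[OF G_linear[OF assms(2)]] by simp
  also have "\<dots> = h r \<bullet> (x - y)"
    using G_inner[OF assms(2)] by blast
  finally show "\<bar>r \<bullet> (g x - g y)\<bar> \<le> e"
    using assms r h by (auto simp: R_close_def G_stable_def)
qed

lemma orbit_translate:
  assumes "g \<in> G"
  shows "orbit (orthogonal_group\<lparr>carrier := G\<rparr>) (\<lambda>g x. g x) (g x) =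
    orbit (orthogonal_group\<lparr>carrier := G\<rparr>) (\<lambda>g x. g x) x"
proof -
  obtain h where h: "h \<in> G" "\<And>x. h (g x) = x" "\<And>x. g (h x) = x"
    using G_inverse[OF assms] by blast
  have "\<exists>f\<in>G. f (g x) = k x" if "k \<in> G" for k
    using G_comp[OF that h(1)] h by (intro bexI[of _ "k \<circ> h"]) simp_all
  moreover have "\<exists>f\<in>G. f x = k (g x)" if "k \<in> G" for k
    using G_comp[OF that assms] by (intro bexI[of _ "k \<circ> g"]) simp_all
  ultimately show ?thesis
    unfolding orbit_def by (auto, metis+)
qed

text \<open>Compactness of the quotient is applied to the images of the open
  \<open>e\<close>-neighbourhoods of the orbits.\<close>

lemma power_orbit_net:
  assumes "compact_space
      (orbit_space (orthogonal_group\<lparr>carrier := G\<rparr>) (diag_action k) (power_space R k))"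
    and "e > 0"
  shows "\<exists>F. finite F \<and>
    (\<forall>r. (\<forall>i<k. r i \<in> R) \<longrightarrow> (\<exists>g\<in>G. \<exists>f\<in>F. \<forall>i<k. norm (r i - g (f i)) < e))"
proof -
  let ?orb = "orbit (orthogonal_group\<lparr>carrier := G\<rparr>) (diag_action k)"
  let ?Rk = "{..<k} \<rightarrow>\<^sub>E R"
  let ?X = "orbit_space (orthogonal_group\<lparr>carrier := G\<rparr>) (diag_action k) (power_space R k)"
  have tsp: "topspace (power_space R k) = ?Rk"
    by (simp add: power_space_def)
  define V where "V f = {r \<in> ?Rk. \<exists>g\<in>G. \<forall>i<k. norm (r i - g (f i)) < e}" for f :: "nat \<Rightarrow> 'a"
  have orb_self: "r \<in> ?orb r" if "r \<in> ?Rk" for r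
  proof -
    have "diag_action k id r = r"
      using that by (simp add: diag_action_def PiE_restrict)
    then show ?thesis
      using G_id unfolding orbit_def by (auto intro!: exI[of _ id])
  qed
  \<comment> \<open>\<open>V f\<close> is a union of orbits because \<open>G\<close> acts by
    isometries. So it is the full preimage of its image, which is therefore open in the
    quotient.\<close>
  have pre: "r \<in> V f" if r: "r \<in> ?Rk" and r': "r' \<in> V f" and eq: "?orb r = ?orb r'" for r r' f
  proof -
    obtain h where h: "h \<in> G" "r = diag_action k h r'"
      using orb_self[OF r] eq by (auto simp: orbit_def)
    obtain g where g: "g \<in> G" "\<forall>i<k. norm (r' i - g (f i)) < e"
      using r' by (auto simp: V_def)
    have "\<forall>i<k. norm (r i - (h \<circ> g) (f i)) < e"
      using g h by (simp add: diag_action_def G_norm_diff)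
    then show ?thesis
      using r G_comp[OF h(1) g(1)] unfolding V_def by blast
  qed
  have "openin (power_space R k) (V f)" for f
  proof -
    have "{r \<in> ?Rk. \<forall>i<k. norm (r i - g (f i)) < e} =
        Pi\<^sub>E {..<k} (\<lambda>i. R \<inter> {x. norm (x - g (f i)) < e})" for g
      by (rule Set.set_eqI) (auto simp: PiE_iff)
    then have "V f = (\<Union>g\<in>G. Pi\<^sub>E {..<k} (\<lambda>i. R \<inter> {x. norm (x - g (f i)) < e}))"
      unfolding V_def by blast
    moreover have "openin (power_space R k) (Pi\<^sub>E {..<k} (\<lambda>i. R \<inter> {x. norm (x - g (f i)) < e}))" for g
    proof -
      have "open {x. norm (x - g (f i)) < e}" for i
        by (intro open_Collect_less continuous_intros)
      then show ?thesis
        unfolding power_space_def by (simp add: openin_PiE openin_open_Int)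
    qed
    ultimately show ?thesis
      by auto
  qed
  moreover have "{r \<in> topspace (power_space R k). ?orb r \<in> ?orb ` V f} = V f" for f
  proof
    show "{r \<in> topspace (power_space R k). ?orb r \<in> ?orb ` V f} \<subseteq> V f"
      using pre unfolding tsp by blast
    show "V f \<subseteq> {r \<in> topspace (power_space R k). ?orb r \<in> ?orb ` V f}"
      unfolding tsp V_def by blast
  qed
  ultimately have "openin ?X (?orb ` V f)" for f
    by (auto simp: openin_orbit_space orbits_def tsp V_def)
  then have op: "\<forall>U\<in>(\<lambda>f. ?orb ` V f) ` ?Rk. openin ?X U"
    by blast
  have V_self: "f \<in> V f" if "f \<in> ?Rk" for f
  proof -
    have "\<forall>i<k. norm (f i - id (f i)) < e"
      using \<open>e > 0\<close> by simp
    then show ?thesis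
      using that G_id unfolding V_def by blast
  qed
  have "topspace ?X \<subseteq> \<Union>((\<lambda>f. ?orb ` V f) ` ?Rk)"
    unfolding topspace_orbit_space orbits_def tsp using V_self by blast
  then have "\<exists>\<F>. finite \<F> \<and> \<F> \<subseteq> (\<lambda>f. ?orb ` V f) ` ?Rk \<and> topspace ?X \<subseteq> \<Union>\<F>"
    by (rule assms(1)[unfolded compact_space_alt, THEN spec, THEN mp, OF conjI[OF op]])
  then obtain F where F: "finite F" "F \<subseteq> ?Rk" "topspace ?X \<subseteq> \<Union>((\<lambda>f. ?orb ` V f) ` F)"
    unfolding ex_finite_subset_image by blast
  show ?thesis
  proof (intro exI conjI allI impI)
    show "finite F"
      by (rule F(1))
    fix r :: "nat \<Rightarrow> 'a"
    assume r: "\<forall>i<k. r i \<in> R"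
    \<comment> \<open>Points of the product space are extensional, whereas \<open>r\<close> is
      arbitrary beyond \<open>k\<close>.\<close>
    define r' where "r' = restrict r {..<k}"
    have r': "r' \<in> ?Rk"
      using r by (auto simp: r'_def)
    then have "?orb r' \<in> topspace ?X"
      by (auto simp: orbits_def tsp)
    then obtain f r'' where "f \<in> F" "r'' \<in> V f" "?orb r' = ?orb r''"
      using F(3) by blast
    then have "f \<in> F" "r' \<in> V f"
      using pre r' by blast+
    then show "\<exists>g\<in>G. \<exists>f\<in>F. \<forall>i<k. norm (r i - g (f i)) < e"
      by (auto simp: V_def r'_def)
  qed
qed

text \<open>Total boundedness modulo \<open>G\<close>: bounded norms limit the number of summands in
  \<open>signed_sum_approximation\<close>, and \<open>power_orbit_net\<close> leaves finitely many
  tuples for each length.\<close>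

lemma orbit_net:
  assumes stable: "G_stable G W" "G_stable G R"
    and W: "bounded W"
    and compact: "\<And>k. compact_space
      (orbit_space (orthogonal_group\<lparr>carrier := G\<rparr>) (diag_action k) (power_space R k))"
    and "e > 0"
  obtains F where "finite F" "F \<subseteq> W" "\<And>w. w \<in> W \<Longrightarrow> \<exists>g\<in>G. \<exists>f\<in>F. R_close R e w (g f)"
proof -
  \<comment> \<open>The case \<open>k = 1\<close> bounds \<open>R\<close>: every \<open>r\<close> is
    within 1 of the orbit of a net point, and \<open>G\<close> preserves norms. The summand 1 also
    makes \<open>C\<close> positive, as the divisions below require.\<close>
  obtain C where C: "C > 0" "\<And>r. r \<in> R \<Longrightarrow> norm r \<le> C"
  proof -
    obtain F where F: "finite F" "\<And>r. (\<forall>i<1. r i \<in> R) \<Longrightarrow>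
        \<exists>g\<in>G. \<exists>f\<in>F. \<forall>i<(1::nat). norm (r i - g (f i)) < 1"
      using power_orbit_net[OF compact[of 1] zero_less_one] by blast
    have bound: "norm r \<le> 1 + (\<Sum>f\<in>F. norm (f 0))" if "r \<in> R" for r
    proof -
      have "\<exists>g\<in>G. \<exists>f\<in>F. norm (r - g (f 0)) < 1"
        using F(2)[of "\<lambda>_. r"] that by simp
      then obtain g f where gf: "g \<in> G" "f \<in> F" "norm (r - g (f 0)) < 1"
        by blast
      have "norm r \<le> norm (r - g (f 0)) + norm (g (f 0))"
        by (metis diff_add_cancel norm_triangle_ineq)
      moreover have "norm (g (f 0)) = norm (f 0)"
        using G_orthogonal[OF gf(1)] orthogonal_transformation_norm by blast
      moreover have "norm (f 0) \<le> (\<Sum>f\<in>F. norm (f 0))"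
        using F(1) gf(2) by (intro member_le_sum) auto
      ultimately show ?thesis
        using gf(3) by linarith
    qed
    moreover have "1 + (\<Sum>f\<in>F. norm (f 0)) > 0"
      by (simp add: add_pos_nonneg sum_nonneg)
    ultimately show thesis
      using that by blast
  qed
  obtain M where M: "\<And>w. w \<in> W \<Longrightarrow> norm w \<le> M"
    using W by (auto simp: bounded_iff)
  \<comment> \<open>Error budget: \<open>d\<close> for the signed sum, \<open>d\<close> for
    replacing its tuple, and twice that again for moving the centre into \<open>W\<close>.\<close>
  define d where "d = e / 4"
  define \<delta> where "\<delta> = d / C\<^sup>2"
  have pos: "d > 0" "\<delta> > 0" "\<delta> * C\<^sup>2 \<le> d"
    using \<open>e > 0\<close> C(1) by (auto simp: d_def \<delta>_def)
  obtain K where K: "M\<^sup>2 / (\<delta> * d) \<le> real K"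
    using real_arch_simple by blast
  \<comment> \<open>If each of \<open>k\<close> vectors is off by \<open>\<eta> k\<close>, the
    combination is off by at most \<open>\<delta> * k * \<eta> k\<close> in norm, hence by at most
    \<open>d\<close> after pairing with \<open>R\<close>. The \<open>+ 1\<close> keeps the
    denominator positive for \<open>k = 0\<close>.\<close>
  define \<eta> where "\<eta> k = d / (C * \<delta> * (real k + 1))" for k
  have \<eta>: "\<eta> k > 0" "C * \<delta> * (real k * \<eta> k) \<le> d" for k
  proof -
    have k: "real k + 1 > 0" and C\<delta>: "C * \<delta> > 0"
      using C(1) pos by simp_all
    then show "\<eta> k > 0"
      unfolding \<eta>_def using pos by (intro divide_pos_pos mult_pos_pos[of "C * \<delta>"])
    then have "C * \<delta> * (real k * \<eta> k) \<le> C * \<delta> * ((real k + 1) * \<eta> k)"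
      using C\<delta> by (intro mult_left_mono mult_right_mono) auto
    also have "\<dots> = d"
      using k C(1) pos by (simp add: \<eta>_def)
    finally show "C * \<delta> * (real k * \<eta> k) \<le> d" .
  qed
  have "\<exists>F. finite F \<and> (\<forall>r. (\<forall>i<k. r i \<in> R) \<longrightarrow>
      (\<exists>g\<in>G. \<exists>f\<in>F. \<forall>i<k. norm (r i - g (f i)) < \<eta> k))" for k
    by (rule power_orbit_net[OF compact \<eta>(1)])
  then obtain \<Phi> where \<Phi>: "\<And>k. finite (\<Phi> k)"
    "\<And>k r. (\<forall>i<k. r i \<in> R) \<Longrightarrow> \<exists>g\<in>G. \<exists>f\<in>\<Phi> k. \<forall>i<k. norm (r i - g (f i)) < \<eta> k"
    by metis
  define comb where "comb k s f = \<delta> *\<^sub>R (\<Sum>i<k. s i *\<^sub>R f i)"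
    for k and s :: "nat \<Rightarrow> real" and f :: "nat \<Rightarrow> 'a"
  \<comment> \<open>Sign patterns are extensional, so that there are finitely many for each
    length.\<close>
  define Z where "Z = (\<Union>k\<le>K. \<Union>s\<in>{..<k} \<rightarrow>\<^sub>E {-1, 1}. comb k s ` \<Phi> k)"
  have "finite Z"
    unfolding Z_def using \<Phi>(1) by (auto intro!: finite_PiE)
  have Z: "\<exists>g\<in>G. \<exists>z\<in>Z. R_close R (2 * d) w (g z)" if w: "w \<in> W" for w
  proof -
    have "(norm w)\<^sup>2 \<le> real K * (\<delta> * d)"
    proof -
      have "(norm w)\<^sup>2 \<le> M\<^sup>2"
        using M[OF w] by (simp add: power_mono)
      then show ?thesis
        using K pos by (simp add: field_simps)
    qed
    then obtain k s r where k: "k \<le> K" and sr: "\<forall>i<k. s i \<in> {-1, 1::real} \<and> r i \<in> R"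
      and close: "R_close R d w (comb k s r)"
      using signed_sum_approximation[OF C(2) pos(2,3) less_imp_le[OF pos(1)],
          where x = w and K = K]
      unfolding comb_def by blast
    obtain g f where gf: "g \<in> G" "f \<in> \<Phi> k" "\<forall>i<k. norm (r i - g (f i)) < \<eta> k"
      using \<Phi>(2)[of k r] sr by blast
    define s' where "s' = restrict s {..<k}"
    have "comb k s' f \<in> Z"
    proof -
      have "s' \<in> {..<k} \<rightarrow>\<^sub>E {-1, 1}"
        using sr by (simp add: s'_def PiE_iff)
      then show ?thesis
        unfolding Z_def using k gf(2) by blast
    qed
    moreover have "R_close R d (comb k s r) (g (comb k s' f))"
    proof (rule norm_imp_R_close[OF C(2)])
      have "g (comb k s' f) = comb k s (\<lambda>i. g (f i))"
        using G_linear[OF gf(1)]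
        by (simp add: comb_def s'_def linear_scale linear_sum)
      then have "comb k s r - g (comb k s' f) = \<delta> *\<^sub>R (\<Sum>i<k. s i *\<^sub>R (r i - g (f i)))"
        by (simp add: comb_def scaleR_diff_right sum_subtractf)
      moreover have "norm (\<Sum>i<k. s i *\<^sub>R (r i - g (f i))) \<le> (\<Sum>i<k. \<eta> k)"
      proof (rule sum_norm_le)
        fix i assume "i \<in> {..<k}"
        then have "\<bar>s i\<bar> = 1" "norm (r i - g (f i)) < \<eta> k"
          using sr gf(3) by auto
        then show "norm (s i *\<^sub>R (r i - g (f i))) \<le> \<eta> k"
          by simp
      qed
      ultimately have "norm (comb k s r - g (comb k s' f)) \<le> \<delta> * (real k * \<eta> k)"
        using pos by simp
      then have "C * norm (comb k s r - g (comb k s' f)) \<le> C * (\<delta> * (real k * \<eta> k))"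
        using C(1) by (intro mult_left_mono) auto
      then show "C * norm (comb k s r - g (comb k s' f)) \<le> d"
        using \<eta>(2)[of k] by (simp add: mult.assoc)
    qed
    ultimately show ?thesis
      using R_close_trans[OF close] gf(1) by fastforce
  qed
  \<comment> \<open>The combinations in \<open>Z\<close> may lie outside \<open>W\<close>. Those
    close to \<open>W\<close> are replaced by nearby points \<open>v z\<close> of \<open>W\<close>,
    which doubles the radius.\<close>
  define Z' where "Z' = {z \<in> Z. \<exists>v\<in>W. R_close R (2 * d) v z}"
  have "\<forall>z\<in>Z'. \<exists>v. v \<in> W \<and> R_close R (2 * d) v z"
    unfolding Z'_def by blast
  then obtain v where v: "\<And>z. z \<in> Z' \<Longrightarrow> v z \<in> W \<and> R_close R (2 * d) (v z) z"
    by metis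
  show thesis
  proof (rule that[of "v ` Z'"])
    show "finite (v ` Z')"
      using \<open>finite Z\<close> by (simp add: Z'_def)
    show "v ` Z' \<subseteq> W"
      using v by blast
    fix w assume w: "w \<in> W"
    obtain g z where g: "g \<in> G" and z: "z \<in> Z" "R_close R (2 * d) w (g z)"
      using Z[OF w] by blast
    obtain h where h: "h \<in> G" "\<And>x. h (g x) = x" "\<And>x. g (h x) = x"
      using G_inverse[OF g] by blast
    \<comment> \<open>Moving \<open>w\<close> back by the inverse of \<open>g\<close> puts a point
      of \<open>W\<close> close to \<open>z\<close> itself, so \<open>z\<close> was retained in
      \<open>Z'\<close>.\<close>
    have hw: "R_close R (2 * d) (h w) z"
      using R_close_G[OF stable(2) h(1) z(2)] h(2) by simp
    moreover have "h w \<in> W"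
      using stable(1) h(1) w by (simp add: G_stable_def)
    ultimately have "z \<in> Z'"
      using z(1) unfolding Z'_def by blast
    then have "R_close R (2 * d + 2 * d) (h w) (v z)"
      using R_close_trans[OF hw] R_close_sym v by blast
    then have "R_close R e w (g (v z))"
      using R_close_G[OF stable(2) g] h(3) by (fastforce simp: d_def)
    then show "\<exists>g\<in>G. \<exists>f\<in>v ` Z'. R_close R e w (g f)"
      using g \<open>z \<in> Z'\<close> by blast
  qed
qed

end

subsection \<open>Compactness of the orbit space\<close>

theorem theorem1:
  fixes G :: "('a::{real_inner, complete_space} \<Rightarrow> 'a) set"
    and W R :: "'a set"
  assumes "subgroup G orthogonal_group"
    and "G_stable G W"
    and "G_stable G R"
    and "compactin weak_topology W"
    and "\<And>k::nat. compact_space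
           (orbit_space (orthogonal_group\<lparr>carrier := G\<rparr>) (diag_action k) (power_space R k))"
  shows "compact_space
           (orbit_space (orthogonal_group\<lparr>carrier := G\<rparr>) (\<lambda>g x. g x) (dR_space W R))"
proof -
  interpret orthogonal_subgroup G
    by (rule orthogonal_subgroup.intro[OF assms(1)])
  let ?orb = "orbit (orthogonal_group\<lparr>carrier := G\<rparr>) (\<lambda>g x. g x)"
  let ?X = "orbit_space (orthogonal_group\<lparr>carrier := G\<rparr>) (\<lambda>g x. g x) (dR_space W R)"
  show ?thesis
    unfolding compact_space_alt
  proof (intro allI impI, elim conjE)
    fix \<U> assume op: "\<forall>U\<in>\<U>. openin ?X U" and cover: "topspace ?X \<subseteq> \<Union>\<U>"
    \<comment> \<open>If \<open>W\<close> itself is not \<open>covered\<close>, ever smaller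
      uncovered pieces can be selected, as in the proof that complete, totally bounded spaces are
      compact.\<close>
    define covered where "covered A \<longleftrightarrow> (\<exists>\<F>. finite \<F> \<and> \<F> \<subseteq> \<U> \<and> ?orb ` A \<subseteq> \<Union>\<F>)" for A
    define N where "N n q = {w \<in> W. \<exists>g\<in>G. R_close R (1 / 2 ^ n) w (g q)}" for n :: nat and q
    have covered_UN: "covered (\<Union>p\<in>F. B p)" if F: "finite F" and cov: "\<And>p. p \<in> F \<Longrightarrow> covered (B p)"
      for F :: "'a set" and B
    proof -
      obtain f where f: "\<And>p. p \<in> F \<Longrightarrow> finite (f p) \<and> f p \<subseteq> \<U> \<and> ?orb ` B p \<subseteq> \<Union>(f p)"
        using cov unfolding covered_def by metis
      then have "finite (\<Union>(f ` F)) \<and> \<Union>(f ` F) \<subseteq> \<U> \<and> ?orb ` (\<Union>p\<in>F. B p) \<subseteq> \<Union>(\<Union>(f ` F))"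
        using F by (fastforce simp: image_UN)
      then show ?thesis
        unfolding covered_def by blast
    qed
    \<comment> \<open>Finitely many sets \<open>N n p\<close> exhaust \<open>W\<close>, so at least
      one of them cuts an uncovered piece out of \<open>B\<close>.\<close>
    have refine: "\<exists>p\<in>W. \<not> covered (B \<inter> N n p)" if "B \<subseteq> W" "\<not> covered B" for B n
    proof -
      obtain F where F: "finite F" "F \<subseteq> W"
        "\<And>w. w \<in> W \<Longrightarrow> \<exists>g\<in>G. \<exists>f\<in>F. R_close R (1 / 2 ^ n) w (g f)"
        using orbit_net[OF assms(2,3) weakly_compact_imp_bounded[OF assms(4)] assms(5),
            of "1 / 2 ^ n"] by (metis zero_less_divide_1_iff zero_less_numeral zero_less_power)
      have "(\<Union>p\<in>F. B \<inter> N n p) = B"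
        using F(3) that(1) by (fastforce simp: N_def)
      then show ?thesis
        using covered_UN[OF F(1), of "\<lambda>p. B \<inter> N n p"] that(2) F(2) by auto
    qed
    have "covered W"
    proof (rule ccontr)
      assume W: "\<not> covered W"
      \<comment> \<open>The choice runs over pairs of an uncovered set and a centre; the second
        condition makes the centres a Cauchy sequence for \<open>d_R\<close>.\<close>
      have "\<exists>f. \<forall>n. (\<not> covered (fst (f n)) \<and> fst (f n) \<subseteq> N n (snd (f n)) \<and> snd (f n) \<in> W) \<and>
          R_close R (2 / 2 ^ n) (snd (f n)) (snd (f (Suc n)))"
      proof (rule dependent_nat_choice)
        show "\<exists>x. \<not> covered (fst x) \<and> fst x \<subseteq> N 0 (snd x) \<and> snd x \<in> W"
          using refine[OF subset_refl W, of 0] by auto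
      next
        fix x :: "'a set \<times> 'a" and n
        assume x: "\<not> covered (fst x) \<and> fst x \<subseteq> N n (snd x) \<and> snd x \<in> W"
        obtain B q where Bq: "x = (B, q)"
          by fastforce
        have B: "\<not> covered B" "B \<subseteq> N n q" "B \<subseteq> W"
          using x Bq by (auto simp: N_def)
        obtain p where p: "p \<in> W" "\<not> covered (B \<inter> N (Suc n) p)"
          using refine[OF B(3,1)] by blast
        \<comment> \<open>The empty family covers the empty set, so an uncovered piece has a point
          \<open>w\<close>, which lies near the orbits of both centres.\<close>
        have "B \<inter> N (Suc n) p \<noteq> {}"
          using p(2) unfolding covered_def by (metis Union_empty empty_subsetI finite.emptyI image_empty)
        then obtain w where w: "w \<in> N n q" "w \<in> N (Suc n) p"
          using B(2) by blast
        obtain g where g: "g \<in> G" "R_close R (1 / 2 ^ n) w (g q)"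
          using w(1) by (auto simp: N_def)
        obtain h where h: "h \<in> G" "R_close R (1 / 2 ^ Suc n) w (h p)"
          using w(2) by (auto simp: N_def)
        obtain g' where g': "g' \<in> G" "\<And>x. g' (g x) = x" "\<And>x. g (g' x) = x"
          using G_inverse[OF g(1)] by blast
        obtain h' where h': "h' \<in> G" "\<And>x. h' (h x) = x" "\<And>x. h (h' x) = x"
          using G_inverse[OF h(1)] by blast
        \<comment> \<open>\<open>p\<close> is close to \<open>q\<close> only modulo
          \<open>G\<close>; this translate of \<open>p\<close> is genuinely close, through
          \<open>g' w\<close>.\<close>
        define q' where "q' = g' (h p)"
        have 1: "R_close R (1 / 2 ^ n) q (g' w)"
          using R_close_G[OF assms(3) g'(1) g(2)] g'(2) R_close_sym by metis
        have 2: "R_close R (1 / 2 ^ Suc n) (g' w) q'"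
          using R_close_G[OF assms(3) g'(1) h(2)] by (simp add: q'_def)
        have "R_close R (2 / 2 ^ n) q q'"
          by (rule R_close_mono[OF R_close_trans[OF 1 2]]) (simp add: field_simps)
        moreover have "q' \<in> W"
          using assms(2) g'(1) h(1) p(1) by (simp add: q'_def G_stable_def)
        \<comment> \<open>\<open>N\<close> depends only on the orbit of its centre, so passing from
          \<open>p\<close> to \<open>q'\<close> loses nothing.\<close>
        moreover have "N (Suc n) p \<subseteq> N (Suc n) q'"
        proof -
          have p_eq: "p = (h' \<circ> g) q'"
            using g'(3) h'(2) by (simp add: q'_def)
          have "f \<circ> (h' \<circ> g) \<in> G" "f p = (f \<circ> (h' \<circ> g)) q'" if "f \<in> G" for f
            using G_comp that g(1) h'(1) p_eq by simp_all
          then show ?thesis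
            unfolding N_def by (smt (verit) Collect_mono)
        qed
        ultimately show "\<exists>y. (\<not> covered (fst y) \<and> fst y \<subseteq> N (Suc n) (snd y) \<and> snd y \<in> W) \<and>
            R_close R (2 / 2 ^ n) (snd x) (snd y)"
          using p(2) Bq by (intro exI[of _ "(B \<inter> N (Suc n) p, q')"]) auto
      qed
      then obtain f where f: "\<forall>n. (\<not> covered (fst (f n)) \<and> fst (f n) \<subseteq> N n (snd (f n)) \<and>
          snd (f n) \<in> W) \<and> R_close R (2 / 2 ^ n) (snd (f n)) (snd (f (Suc n)))"
        by blast
      define B q where "B n = fst (f n)" and "q n = snd (f n)" for n
      have B: "\<And>n. \<not> covered (B n)" "\<And>n. B n \<subseteq> N n (q n)"
        and q: "\<And>n. q n \<in> W" "\<And>n. R_close R (2 / 2 ^ n) (q n) (q (Suc n))"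
        using f by (simp_all add: B_def q_def)
      \<comment> \<open>The radius is the tail sum of the steps \<open>2 / 2 ^ n\<close>; since
        \<open>2 / 2 ^ n + 4 / 2 ^ Suc n = 4 / 2 ^ n\<close>, the balls are nested.\<close>
      define D where "D n = W \<inter> {y. R_close R (4 / 2 ^ n) (q n) y}" for n
      have "(\<Inter>n. D n) \<noteq> {}"
      proof (rule compact_space_imp_nest[of "subtopology weak_topology W"])
        show "compact_space (subtopology weak_topology W)"
          using assms(4) by (rule compact_space_subtopology)
        show "closedin (subtopology weak_topology W) (D n)" for n
          unfolding D_def by (metis closedin_subtopology_Int_closed closedin_weak_R_close)
        show "D n \<noteq> {}" for n
          using q(1)[of n] R_close_self[of "4 / 2 ^ n" R "q n"] by (auto simp: D_def)
        have "D (Suc n) \<subseteq> D n" for n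
          using R_close_trans[OF q(2)[of n]] by (fastforce simp: D_def elim: R_close_mono)
        then show "decseq D"
          by (simp add: decseq_SucI)
      qed
      then obtain a where a: "a \<in> W" "\<And>n. R_close R (4 / 2 ^ n) (q n) a"
        by (auto simp: D_def)
      obtain U where U: "U \<in> \<U>" "?orb a \<in> U"
        using cover a(1) by (auto simp: orbits_def)
      then have "openin (dR_space W R) {x \<in> W. ?orb x \<in> U}"
        using op by (auto simp: openin_orbit_space)
      then obtain e where e: "e > 0" "\<And>y. y \<in> W \<Longrightarrow> d_R R a y < e \<Longrightarrow> ?orb y \<in> U"
        using a(1) U(2) unfolding openin_dR_space by blast
      \<comment> \<open>\<open>e\<close> is an \<open>ennreal\<close> and may be infinite, so a
        positive real below it is taken.\<close>
      obtain d where d: "d > 0" "ennreal d < e"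
        using e(1) by (metis ennreal_less_zero_iff dense ennreal_cases less_top_ennreal not_less_iff_gr_or_eq order_less_trans top.not_eq_extremum)
      \<comment> \<open>The 5 adds the distance 1 from \<open>w\<close> to the orbit of
        \<open>q n\<close> and 4 from \<open>q n\<close> to \<open>a\<close>, in units of
        \<open>1 / 2 ^ n\<close>.\<close>
      obtain n where n: "5 / d < 2 ^ n"
        using real_arch_pow[of 2 "5 / d"] by auto
      \<comment> \<open>A translate of \<open>w\<close> is within \<open>d\<close> of
        \<open>a\<close> and has the same orbit as \<open>w\<close>. Thus the single set
        \<open>U\<close> covers \<open>B n\<close>, the desired contradiction.\<close>
      have "?orb w \<in> U" if wB: "w \<in> B n" for w
      proof -
        obtain g where g: "g \<in> G" "R_close R (1 / 2 ^ n) w (g (q n))" and w: "w \<in> W"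
          using subsetD[OF B(2) wB] by (auto simp: N_def)
        obtain h where h: "h \<in> G" "\<And>x. h (g x) = x" "\<And>x. g (h x) = x"
          using G_inverse[OF g(1)] by blast
        have "R_close R (1 / 2 ^ n) (h w) (q n)"
          using R_close_G[OF assms(3) h(1) g(2)] h(2) by simp
        then have "R_close R (1 / 2 ^ n + 4 / 2 ^ n) (h w) a"
          using R_close_trans a(2) by blast
        moreover have "1 / 2 ^ n + 4 / 2 ^ n \<le> d"
          using n d(1) by (simp add: field_simps)
        ultimately have "R_close R d a (h w)"
          using R_close_mono R_close_sym by blast
        then have "d_R R a (h w) < e"
          using R_close_imp_d_R_le d(2) by (metis order_le_less_trans)
        moreover have "h w \<in> W"
          using assms(2) h(1) w by (simp add: G_stable_def)
        ultimately show ?thesis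
          using e(2) orbit_translate[OF h(1)] by metis
      qed
      then have "covered (B n)"
        unfolding covered_def using U(1) by (intro exI[of _ "{U}"]) auto
      then show False
        using B(1) by blast
    qed
    then show "\<exists>\<F>. finite \<F> \<and> \<F> \<subseteq> \<U> \<and> topspace ?X \<subseteq> \<Union>\<F>"
      unfolding covered_def by (auto simp: orbits_def image_subset_iff subset_iff)
  qed
qed

end
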